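(* Assume $\mathfrak d=\mathfrak c$. Then there is a $\mathfrak c$-K-Lusin set $E$ in $\mathbb P$ of cardinality $\mathfrak c$ and a continuous function $f:E\to\mathbb R$ which is not uniformly continuous on any subset of $E$ of cardinality $\mathfrak c$. In particular, $\mathfrak d=\mathfrak c$ implies $C_8(\mathfrak c,\mathfrak c)$.
   Context: $\mathfrak c=2^{\aleph_0}$; $\mathfrak d$ is the smallest cardinality of a dominating family in $\mathbb N^{\mathbb N}$ with respect to eventual domination $\leq^*$. $\mathbb P$ denotes the set of irrational numbers in $[0,1]$. For a Polish space $X$ and a cardinal $\aleph_1\leq\kappa\leq\mathfrak c$, an uncountable set $E\subseteq X$ is a $\kappa$-K-Lusin set in $X$ if $|E\cap K|<\kappa$ for every compact $K\subseteq X$. $C_8(\mathfrak c,\mathfrak c)$ is the statement: there exist a set $E\subseteq\mathbb R$ of cardinality $\mathfrak c$ and a continuous function $f:E\to\mathbb R$ which is not uniformly continuous on any subset of $E$ of cardinality $\mathfrak c$. *)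

theory Defs
  imports "HOL-Analysis.Analysis"
begin

(* "=o" would otherwise be ambiguous with the membership abbreviation of Set_Algebras *)
no_notation Set_Algebras.elt_set_eq (infix \<open>=o\<close> 50)
unbundle cardinal_syntax

text \<open>
  Cardinals are represented by cardinal orders as in \<^theory>\<open>HOL.BNF_Cardinal_Order_Relation\<close>;
  equality of cardinals is \<open>=o\<close>, which, like \<open>\<le>o\<close> and \<open><o\<close>, may relate orders over different types.
\<close>

definition continuum :: "(nat \<Rightarrow> bool) rel" where
  "continuum = ctwo ^c natLeq"

definition eventually_dominated :: "(nat \<Rightarrow> nat) \<Rightarrow> (nat \<Rightarrow> nat) \<Rightarrow> bool" (infix \<open>\<le>*\<close> 50) where
  "f \<le>* g \<longleftrightarrow> (\<forall>\<^sub>F n in sequentially. f n \<le> g n)"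

definition dominating :: "(nat \<Rightarrow> nat) set \<Rightarrow> bool" where
  "dominating D \<longleftrightarrow> (\<forall>f. \<exists>g\<in>D. f \<le>* g)"

text \<open>The choice is immaterial: any two least elements are related by \<open>=o\<close>.\<close>

definition dominating_number :: "(nat \<Rightarrow> nat) rel" where
  "dominating_number =
     (SOME r. (\<exists>D. dominating D \<and> r = |D| ) \<and> (\<forall>D. dominating D \<longrightarrow> r \<le>o |D| ))"

lemma dominating_number_least:
  shows "\<exists>D. dominating D \<and> dominating_number = |D|"
    and "\<And>D. dominating D \<Longrightarrow> dominating_number \<le>o |D|"
proof -
  let ?R = "card_of ` {D. dominating D}"
  have "dominating UNIV"
    unfolding dominating_def eventually_dominated_def by (metis UNIV_I eventuallyI order_refl)
  then have "?R \<noteq> {}" by blast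
  moreover have "\<forall>r\<in>?R. Card_order r" by (auto simp: card_of_Card_order)
  ultimately have "\<exists>r\<in>?R. \<forall>r'\<in>?R. r \<le>o r'" by (rule exists_minim_Card_order)
  then have "\<exists>r. (\<exists>D. dominating D \<and> r = |D| ) \<and> (\<forall>D. dominating D \<longrightarrow> r \<le>o |D| )"
    by blast
  from someI_ex[OF this, folded dominating_number_def]
  show "\<exists>D. dominating D \<and> dominating_number = |D|"
    and "\<And>D. dominating D \<Longrightarrow> dominating_number \<le>o |D|" by blast+
qed

definition Polish :: "'a topology \<Rightarrow> bool" where
  "Polish X \<longleftrightarrow> completely_metrizable_space X \<and> second_countable X"

text \<open>
  The restrictions on \<open>\<kappa>\<close> and \<open>X\<close> under which the notion is introduced are part of the predicate;
  \<open>cardSuc natLeq\<close> is the first uncountable cardinal.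
\<close>

definition K_Lusin :: "'k rel \<Rightarrow> 'a topology \<Rightarrow> 'a set \<Rightarrow> bool" where
  "K_Lusin \<kappa> X E \<longleftrightarrow>
     Polish X \<and> Card_order \<kappa> \<and> cardSuc natLeq \<le>o \<kappa> \<and> \<kappa> \<le>o continuum \<and>
     E \<subseteq> topspace X \<and> uncountable E \<and> (\<forall>K. compactin X K \<longrightarrow> |E \<inter> K| <o \<kappa>)"

definition irrationals01 :: "real set" where
  "irrationals01 = {0..1} - \<rat>"

lemma continuum_bounds:
  shows "Card_order continuum" and "cardSuc natLeq \<le>o continuum" and "continuum \<le>o continuum"
  unfolding continuum_def
  by (rule Card_order_cexp)
    (rule cardSuc_least[OF natLeq_Card_order Card_order_cexp ordLess_ctwo_cexp[OF natLeq_Card_order]],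
     rule ordLeq_refl[OF Card_order_cexp])

lemma Polish_irrationals01: "Polish (top_of_set irrationals01)"
proof -
  have second: "second_countable (euclidean :: real topology)"
  proof -
    obtain B :: "real set set" where B: "countable B" "topological_basis B"
      using ex_countable_basis by blast
    then have "\<forall>V\<in>B. openin euclidean V"
      by (simp add: topological_basis_open)
    moreover have "\<forall>U x. openin euclidean U \<and> x \<in> U \<longrightarrow> (\<exists>V\<in>B. x \<in> V \<and> V \<subseteq> U)"
      using topological_basisE[OF B(2)] by (metis open_openin)
    ultimately show ?thesis
      unfolding second_countable_def using B(1) by blast
  qed
  have rat: "fsigma_in (euclidean :: real topology) \<rat>"
  proof -
    have "fsigma_in (euclidean :: real topology) (\<Union>((\<lambda>x. {x}) ` \<rat>))"
      by (rule fsigma_in_Union) (auto simp: countable_rat intro!: closed_imp_fsigma_in)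
    then show ?thesis by simp
  qed
  have "gdelta_in (euclidean :: real topology) {0..1}"
    by (rule closed_imp_gdelta_in[OF metrizable_space_euclidean]) simp
  from gdelta_in_diff[OF this rat]
  have "completely_metrizable_space (top_of_set irrationals01)"
    unfolding irrationals01_def
    by (rule completely_metrizable_space_gdelta_in[OF completely_metrizable_space_euclidean])
  with second_countable_subtopology[OF second] show ?thesis
    by (simp add: Polish_def)
qed

text \<open>The statement $C_8(\mathfrak c,\mathfrak c)$.\<close>

definition C8_continuum :: bool where
  "C8_continuum \<longleftrightarrow>
     (\<exists>(E :: real set) (f :: real \<Rightarrow> real).
        |E| =o continuum \<and> continuous_on E f \<and>
        (\<forall>A\<subseteq>E. |A| =o continuum \<longrightarrow> \<not> uniformly_continuous_on A f))"

end

theory Submission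
  imports Defs
begin

text \<open>
  Continued fraction digits provide a continuous function \<open>f\<close> on the irrationals (reading parities of
  the even-indexed digits) whose fibres over \<open>[0,1)\<close> leave the odd-indexed digits free; since those
  digits are bounded on compact sets, no such fibre is covered by fewer than $\mathfrak d$ compact
  sets of irrationals. If \<open>f\<close> is uniformly continuous on \<open>A\<close>, the closure \<open>C\<close> of its graph over \<open>A\<close> is
  the graph of a function, so for a value \<open>y\<close> outside a countable set the compact section
  \<open>{x. (x, y) \<in> C}\<close> contains no rational. Hence a transfinite recursion of length $\mathfrak c$ can
  pick first a new value \<open>y\<close> outside the fewer than $\mathfrak c$ forbidden ones, and then a point of
  the fibre over \<open>y\<close> outside the sections of all closed sets \<open>C\<close> treated so far. The sets \<open>K \<times> \<real>\<close> with \<open>K\<close>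
  compact are treated by the same recursion, which yields the K-Lusin property.
\<close>

subsection \<open>Continued fraction digits\<close>

text \<open>Off the integers the floor is locally constant, so the composite is locally constant on
  \<open>S\<close> whatever \<open>h\<close> is.\<close>

lemma continuous_on_comp_floor:
  fixes g :: "'a::topological_space \<Rightarrow> real" and h :: "int \<Rightarrow> 'b::topological_space"
  assumes "continuous_on S g" and "\<And>x. x \<in> S \<Longrightarrow> g x \<notin> \<int>"
  shows "continuous_on S (\<lambda>x. h \<lfloor>g x\<rfloor>)"
  unfolding continuous_on_def
proof
  fix x assume "x \<in> S"
  with assms have "(g \<longlongrightarrow> g x) (at x within S)" "g x \<notin> \<int>"
    by (auto simp: continuous_on_def)
  from eventually_floor_eq[OF this]
  have "\<forall>\<^sub>F y in at x within S. h \<lfloor>g y\<rfloor> = h \<lfloor>g x\<rfloor>"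
    by eventually_elim simp
  then show "((\<lambda>y. h \<lfloor>g y\<rfloor>) \<longlongrightarrow> h \<lfloor>g x\<rfloor>) (at x within S)"
    by (rule tendsto_eventually)
qed

lemma irrationals01_iff: "x \<in> irrationals01 \<longleftrightarrow> 0 < x \<and> x < 1 \<and> x \<notin> \<rat>"
  unfolding irrationals01_def by (auto simp: less_le)

definition gauss_map :: "real \<Rightarrow> real" where
  "gauss_map x = frac (1 / x)"

text \<open>The partial quotients are positive; subtracting 1 makes every sequence in \<open>nat \<Rightarrow> nat\<close> occur.\<close>

definition cf_digit :: "nat \<Rightarrow> real \<Rightarrow> nat" where
  "cf_digit n x = nat \<lfloor>1 / (gauss_map ^^ n) x\<rfloor> - 1"

lemma inverse_not_Rats: "x \<in> irrationals01 \<Longrightarrow> 1 / x \<notin> \<rat>"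
  unfolding irrationals01_iff using Rats_inverse[of "1 / x"] by auto

lemma gauss_map_irrationals01:
  assumes "x \<in> irrationals01"
  shows "gauss_map x \<in> irrationals01"
proof -
  have *: "1 / x \<notin> \<rat>" by (rule inverse_not_Rats[OF assms])
  have "gauss_map x \<notin> \<rat>"
  proof
    assume "gauss_map x \<in> \<rat>"
    then have "frac (1 / x) + of_int \<lfloor>1 / x\<rfloor> \<in> \<rat>"
      unfolding gauss_map_def by (intro Rats_add Rats_of_int)
    with * show False by (simp add: frac_def)
  qed
  moreover from this have "gauss_map x \<noteq> 0" by auto
  ultimately show ?thesis
    unfolding irrationals01_iff gauss_map_def using frac_ge_0[of "1 / x"] frac_lt_1[of "1 / x"]
    by linarith
qed

lemma gauss_map_funpow_irrationals01:
  "x \<in> irrationals01 \<Longrightarrow> (gauss_map ^^ n) x \<in> irrationals01"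
  by (induction n) (auto intro: gauss_map_irrationals01)

lemma continuous_on_inverse_funpow:
  assumes "continuous_on irrationals01 (gauss_map ^^ n)"
  shows "continuous_on irrationals01 (\<lambda>x. 1 / (gauss_map ^^ n) x)"
proof (rule continuous_on_divide[OF continuous_on_const assms], intro ballI)
  fix x assume "x \<in> irrationals01"
  from gauss_map_funpow_irrationals01[OF this, of n]
  show "(gauss_map ^^ n) x \<noteq> 0" by (simp add: irrationals01_iff)
qed

lemma inverse_funpow_not_Ints:
  "x \<in> irrationals01 \<Longrightarrow> 1 / (gauss_map ^^ n) x \<notin> \<int>"
  using inverse_not_Rats[OF gauss_map_funpow_irrationals01] Ints_subset_Rats by blast

lemma continuous_on_gauss_map_funpow:
  "continuous_on irrationals01 (gauss_map ^^ n)"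
proof (induction n)
  case 0
  show ?case by (simp add: id_def continuous_on_id)
next
  case (Suc n)
  have "continuous_on irrationals01 (\<lambda>x. real_of_int \<lfloor>1 / (gauss_map ^^ n) x\<rfloor>)"
    by (rule continuous_on_comp_floor[OF continuous_on_inverse_funpow[OF Suc] inverse_funpow_not_Ints])
  with continuous_on_inverse_funpow[OF Suc]
  have "continuous_on irrationals01 (\<lambda>x. 1 / (gauss_map ^^ n) x - real_of_int \<lfloor>1 / (gauss_map ^^ n) x\<rfloor>)"
    by (rule continuous_on_diff)
  moreover have "gauss_map ^^ Suc n
      = (\<lambda>x. 1 / (gauss_map ^^ n) x - real_of_int \<lfloor>1 / (gauss_map ^^ n) x\<rfloor>)"
    by (rule ext) (simp add: gauss_map_def[of "(gauss_map ^^ n) _"] frac_def)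
  ultimately show ?case by simp
qed

text \<open>A free \<open>h\<close> lets one lemma serve both the digits read as reals and the terms
  of a series in them.\<close>

lemma continuous_on_cf_digit:
  fixes h :: "nat \<Rightarrow> 'b::topological_space"
  shows "continuous_on irrationals01 (\<lambda>x. h (cf_digit n x))"
  unfolding cf_digit_def
  by (rule continuous_on_comp_floor[where h = "\<lambda>i. h (nat i - 1)"
        and g = "\<lambda>x. 1 / (gauss_map ^^ n) x"])
    (rule continuous_on_inverse_funpow[OF continuous_on_gauss_map_funpow], rule inverse_funpow_not_Ints)

text \<open>Each digit is continuous, hence bounded on \<open>K\<close>. This is the link between
  compactness and domination in \<open>nat \<Rightarrow> nat\<close>.\<close>

lemma cf_digit_bounded_on_compact:
  assumes "compact K" and "K \<subseteq> irrationals01"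
  obtains g where "\<And>x n. x \<in> K \<Longrightarrow> cf_digit n x \<le> g n"
proof -
  have "\<exists>m::nat. \<forall>x\<in>K. cf_digit n x \<le> m" for n
  proof -
    have "compact ((\<lambda>x. real (cf_digit n x)) ` K)"
      by (rule compact_continuous_image[OF continuous_on_subset[OF continuous_on_cf_digit assms(2)] assms(1)])
    then have "bdd_above ((\<lambda>x. real (cf_digit n x)) ` K)"
      by (rule bounded_imp_bdd_above[OF compact_imp_bounded])
    then obtain B where B: "\<forall>x\<in>K. real (cf_digit n x) \<le> B"
      unfolding bdd_above_def by blast
    have "\<forall>x\<in>K. cf_digit n x \<le> nat \<lceil>B\<rceil>"
    proof
      fix x assume "x \<in> K"
      with B have "real (cf_digit n x) \<le> B" by blast
      also have "B \<le> real (nat \<lceil>B\<rceil>)" by (rule real_nat_ceiling_ge)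
      finally show "cf_digit n x \<le> nat \<lceil>B\<rceil>" by simp
    qed
    then show ?thesis by blast
  qed
  then show thesis using that by metis
qed

text \<open>The closed interval of the points whose first \<open>n\<close> partial quotients are \<open>Suc (z i)\<close>, up to
  endpoints.\<close>

primrec cf_interval :: "(nat \<Rightarrow> nat) \<Rightarrow> nat \<Rightarrow> real set" where
  "cf_interval z 0 = {0..1}"
| "cf_interval z (Suc n) = (\<lambda>t. 1 / (real (Suc (z 0)) + t)) ` cf_interval (\<lambda>i. z (Suc i)) n"

lemma cf_interval_01: "cf_interval z n \<subseteq> {0..1}"
proof (induction n arbitrary: z)
  case (Suc n)
  show ?case
  proof
    fix x assume "x \<in> cf_interval z (Suc n)"
    then obtain t where "t \<in> cf_interval (\<lambda>i. z (Suc i)) n" and x: "x = 1 / (real (Suc (z 0)) + t)"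
      by auto
    with Suc have "0 \<le> t" by fastforce
    then show "x \<in> {0..1}" unfolding x by simp
  qed
qed simp

lemma cf_interval_Suc_subset: "cf_interval z (Suc n) \<subseteq> cf_interval z n"
proof (induction n arbitrary: z)
  case 0
  show ?case using cf_interval_01[of z "Suc 0"] by simp
next
  case (Suc n)
  show ?case unfolding cf_interval.simps(2)[of z] by (rule image_mono[OF Suc])
qed

lemma cf_interval_compact_nonempty: "compact (cf_interval z n) \<and> cf_interval z n \<noteq> {}"
proof (induction n arbitrary: z)
  case (Suc n)
  have "continuous_on (cf_interval (\<lambda>i. z (Suc i)) n) (\<lambda>t. 1 / (real (Suc (z 0)) + t))"
  proof (intro continuous_intros ballI)
    fix t assume "t \<in> cf_interval (\<lambda>i. z (Suc i)) n"
    then have "0 \<le> t" using cf_interval_01 by fastforce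
    then show "real (Suc (z 0)) + t \<noteq> 0" by simp
  qed
  from compact_continuous_image[OF this] Suc show ?case by simp
qed simp

lemma cf_interval_Inter_nonempty: "(\<Inter>n. cf_interval z n) \<noteq> {}"
proof (rule compact_nest)
  show "cf_interval z n \<subseteq> cf_interval z m" if "m \<le> n" for m n
    by (rule lift_Suc_antimono_le[where f = "cf_interval z", OF cf_interval_Suc_subset that])
qed (simp_all add: cf_interval_compact_nonempty del: cf_interval.simps)

text \<open>Each level yields some preimage of \<open>x\<close>, but \<open>x\<close> determines it
  as \<open>1 / x - Suc (z 0)\<close>, so a single tail \<open>t\<close> works at all
  levels.\<close>

lemma cf_interval_shift:
  assumes x: "x \<in> (\<Inter>n. cf_interval z n)"
  obtains t where "t \<in> (\<Inter>n. cf_interval (\<lambda>i. z (Suc i)) n)" "0 < x" "x = 1 / (real (Suc (z 0)) + t)"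
proof -
  define t where "t = 1 / x - real (Suc (z 0))"
  have *: "t \<in> cf_interval (\<lambda>i. z (Suc i)) n \<and> 0 < x" for n
  proof -
    from x have "x \<in> cf_interval z (Suc n)" by blast
    then obtain t' where t': "t' \<in> cf_interval (\<lambda>i. z (Suc i)) n"
      and eq: "x = 1 / (real (Suc (z 0)) + t')"
      by auto
    from t' have "0 \<le> t'" using cf_interval_01 by fastforce
    then have "0 < x" unfolding eq by simp
    moreover have "t = t'" unfolding t_def eq by simp
    ultimately show ?thesis using t' by simp
  qed
  then have "0 < x" by blast
  with * show thesis by (intro that[of t]) (auto simp: t_def)
qed

lemma cf_interval_Inter_01:
  assumes x: "x \<in> (\<Inter>n. cf_interval z n)"
  shows "0 < x" "x < 1"
proof -
  obtain t where t: "t \<in> (\<Inter>n. cf_interval (\<lambda>i. z (Suc i)) n)" "0 < x" "x = 1 / (real (Suc (z 0)) + t)"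
    using cf_interval_shift[OF x] by blast
  \<comment> \<open>The shift applied to the tail itself gives strict positivity, so the denominator
    of \<open>x\<close> exceeds 1.\<close>
  have "0 < t"
    by (rule cf_interval_shift[OF t(1)])
  show "0 < x" by (rule t(2))
  show "x < 1" unfolding t(3) using \<open>0 < t\<close> by simp
qed

text \<open>The Gauss map lowers the denominator of a rational number, so no rational number has
  infinitely many digits.\<close>

lemma cf_interval_Inter_irrational:
  assumes "x \<in> (\<Inter>n. cf_interval z n)" and "0 < q"
  shows "x * real q \<noteq> real p"
  using assms
proof (induction q arbitrary: x z p rule: less_induct)
  case (less q)
  show ?case
  proof
    assume eq: "x * real q = real p"
    note x = cf_interval_Inter_01[OF less.prems(1)]
    obtain t where t: "t \<in> (\<Inter>n. cf_interval (\<lambda>i. z (Suc i)) n)" "x = 1 / (real (Suc (z 0)) + t)"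
      using cf_interval_shift[OF less.prems(1)] by blast
    note t01 = cf_interval_Inter_01[OF t(1)]
    have p: "0 < p" using eq x less.prems(2) by (cases p) auto
    have "real p < real q" using mult_strict_right_mono[OF x(2), of "real q"] eq less.prems(2) by simp
    then have "p < q" by simp
    \<comment> \<open>The tail is \<open>(q - Suc (z 0) * p) / p\<close>, a fraction with
      denominator \<open>p < q\<close>; since \<open>t\<close> is positive, the subtraction is exact
      in the naturals.\<close>
    have "real q = real p * (real (Suc (z 0)) + t)"
      using eq t01 unfolding t(2) by (simp add: field_simps)
    then have *: "t * real p = real q - real (Suc (z 0) * p)" by (simp add: algebra_simps)
    moreover have "0 < t * real p" using t01 p by simp
    ultimately have "Suc (z 0) * p < q" by (metis diff_gt_0_iff_gt of_nat_less_iff)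
    with * have "t * real p = real (q - Suc (z 0) * p)" by (simp add: of_nat_diff)
    with less.IH[OF \<open>p < q\<close> t(1) p] show False by blast
  qed
qed

lemma cf_interval_Inter_subset: "(\<Inter>n. cf_interval z n) \<subseteq> irrationals01"
proof
  fix x assume x: "x \<in> (\<Inter>n. cf_interval z n)"
  have "x \<notin> \<rat>"
  proof
    assume "x \<in> \<rat>"
    then obtain m n :: nat where "n \<noteq> 0" "\<bar>x\<bar> = real m / real n"
      by (rule Rats_abs_nat_div_natE)
    with cf_interval_Inter_01[OF x] have "0 < n" "x * real n = real m" by simp_all
    with cf_interval_Inter_irrational[OF x, of n m] show False by simp
  qed
  with cf_interval_Inter_01[OF x] show "x \<in> irrationals01" by (simp add: irrationals01_iff)
qed

text \<open>Since the tail lies strictly between 0 and 1, the floor of \<open>1 / x\<close> is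
  exactly \<open>Suc (z 0)\<close>, and the Gauss map sends \<open>x\<close> to the tail, which
  belongs to the shifted sequence.\<close>

lemma cf_digit_cf_interval:
  assumes "x \<in> (\<Inter>n. cf_interval z n)"
  shows "cf_digit n x = z n"
  using assms
proof (induction n arbitrary: x z)
  case (0 x z)
  obtain t where t: "t \<in> (\<Inter>n. cf_interval (\<lambda>i. z (Suc i)) n)" "x = 1 / (real (Suc (z 0)) + t)"
    using cf_interval_shift[OF 0] by blast
  have "\<lfloor>1 / x\<rfloor> = int (Suc (z 0))"
    unfolding t(2) using cf_interval_Inter_01[OF t(1)] by (simp add: floor_eq_iff)
  then show ?case by (simp add: cf_digit_def)
next
  case (Suc n x z)
  obtain t where t: "t \<in> (\<Inter>n. cf_interval (\<lambda>i. z (Suc i)) n)" "x = 1 / (real (Suc (z 0)) + t)"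
    using cf_interval_shift[OF Suc.prems] by blast
  have "\<lfloor>1 / x\<rfloor> = int (Suc (z 0))"
    unfolding t(2) using cf_interval_Inter_01[OF t(1)] by (simp add: floor_eq_iff)
  then have "gauss_map x = t" by (simp add: gauss_map_def frac_def t(2))
  then have "cf_digit (Suc n) x = cf_digit n t"
    by (simp add: cf_digit_def funpow_swap1)
  then show ?case using Suc.IH[OF t(1)] by simp
qed

lemma cf_digits_surj: "\<exists>x\<in>irrationals01. \<forall>n. cf_digit n x = z n"
proof -
  obtain x where x: "x \<in> (\<Inter>n. cf_interval z n)"
    using cf_interval_Inter_nonempty[of z] by (meson ex_in_conv)
  show ?thesis
  proof
    show "\<forall>n. cf_digit n x = z n" by (intro allI cf_digit_cf_interval[OF x])
    show "x \<in> irrationals01" by (rule subsetD[OF cf_interval_Inter_subset x])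
  qed
qed

subsection \<open>A continuous function with large fibres\<close>

text \<open>A binary expansion whose bits are parities of digits.\<close>

definition parity_sum :: "real \<Rightarrow> real" where
  "parity_sum x = (\<Sum>n. of_bool (odd (cf_digit (2 * n) x)) * (1 / 2) ^ Suc n)"

lemma summable_half_Suc: "summable (\<lambda>n. (1 / 2) ^ Suc n :: real)"
  by (simp add: summable_mult)

lemma continuous_on_parity_sum: "continuous_on irrationals01 parity_sum"
proof -
  have "uniform_limit irrationals01
      (\<lambda>N x. \<Sum>n<N. of_bool (odd (cf_digit (2 * n) x)) * (1 / 2) ^ Suc n) parity_sum sequentially"
    unfolding parity_sum_def
    by (rule Weierstrass_m_test[OF _ summable_half_Suc]) auto
  moreover have "\<forall>\<^sub>F N in sequentially. continuous_on irrationals01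
      (\<lambda>x. \<Sum>n<N. of_bool (odd (cf_digit (2 * n) x)) * (1 / 2 :: real) ^ Suc n)"
    \<comment> \<open>Each summand is a function of one digit only, so it is absorbed into
      \<open>h\<close>.\<close>
    by (intro always_eventually allI continuous_on_sum
        continuous_on_cf_digit[where h = "\<lambda>i. of_bool (odd i) * _"])
  ultimately show ?thesis
    by (rule uniform_limit_theorem[rotated, OF _ sequentially_bot])
qed

text \<open>The partial sum of length \<open>N\<close> is \<open>y\<close> truncated to
  \<open>N\<close> binary places, which differs from \<open>y\<close> by at most
  \<open>(1 / 2) ^ N\<close>.\<close>

lemma binary_expansion_floor:
  fixes y :: real
  assumes "0 \<le> y" "y < 1"
  shows "(\<lambda>n. of_bool (odd \<lfloor>2 ^ Suc n * y\<rfloor>) * (1 / 2) ^ Suc n) sums y"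
proof -
  have part: "(\<Sum>n<N. of_bool (odd \<lfloor>2 ^ Suc n * y\<rfloor>) * (1 / 2) ^ Suc n) = real_of_int \<lfloor>2 ^ N * y\<rfloor> / 2 ^ N" for N
  proof (induction N)
    case 0
    from assms have "\<lfloor>y\<rfloor> = 0" by (simp add: floor_eq_iff)
    then show ?case by simp
  next
    case (Suc N)
    define k where "k = \<lfloor>2 ^ Suc N * y\<rfloor>"
    have "\<lfloor>2 ^ N * y\<rfloor> = k div 2"
      unfolding k_def using floor_divide_real_eq_div[of 2 "2 ^ Suc N * y"] by simp
    moreover have "2 * (k div 2) + of_bool (odd k) = k"
      by simp
    then have "2 * real_of_int (k div 2) + of_bool (odd k) = real_of_int k"
      by (metis of_int_add of_int_mult of_int_numeral of_int_of_bool)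
    ultimately have "(real_of_int \<lfloor>2 ^ N * y\<rfloor> / 2 ^ N) + of_bool (odd k) * (1 / 2) ^ Suc N = real_of_int k / 2 ^ Suc N"
      by (cases "odd k") (simp_all add: power_one_over field_simps)
    with Suc show ?case
      by (simp add: k_def)
  qed
  have "(\<lambda>N. real_of_int \<lfloor>2 ^ N * y\<rfloor> / 2 ^ N) \<longlonglongrightarrow> y"
  proof (rule tendsto_sandwich)
    show "\<forall>\<^sub>F N in sequentially. y - (1 / 2) ^ N \<le> real_of_int \<lfloor>2 ^ N * y\<rfloor> / 2 ^ N"
    proof (intro always_eventually allI)
      fix N
      have "2 ^ N * y - 1 \<le> real_of_int \<lfloor>2 ^ N * y\<rfloor>" by linarith
      then have "(2 ^ N * y - 1) / 2 ^ N \<le> real_of_int \<lfloor>2 ^ N * y\<rfloor> / 2 ^ N"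
        by (rule divide_right_mono) simp
      then show "y - (1 / 2) ^ N \<le> real_of_int \<lfloor>2 ^ N * y\<rfloor> / 2 ^ N"
        by (simp add: diff_divide_distrib power_one_over)
    qed
    show "\<forall>\<^sub>F N in sequentially. real_of_int \<lfloor>2 ^ N * y\<rfloor> / 2 ^ N \<le> y"
    proof (intro always_eventually allI)
      fix N
      have "real_of_int \<lfloor>2 ^ N * y\<rfloor> \<le> 2 ^ N * y" by linarith
      then show "real_of_int \<lfloor>2 ^ N * y\<rfloor> / 2 ^ N \<le> y"
        by (simp add: field_simps)
    qed
    have "(\<lambda>N. y - (1 / 2) ^ N) \<longlonglongrightarrow> y - 0"
      by (intro tendsto_intros) auto
    then show "(\<lambda>N. y - (1 / 2) ^ N) \<longlonglongrightarrow> y" by simp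
  qed auto
  then show ?thesis unfolding sums_def part .
qed

lemma parity_sum_fibre:
  assumes "0 \<le> y" "y < 1"
  shows "\<exists>x\<in>irrationals01. parity_sum x = y \<and> (\<forall>n. cf_digit (2 * n + 1) x = z n)"
proof -
  obtain x where x: "x \<in> irrationals01"
    \<comment> \<open>The even-indexed digits are themselves the bits 0 and 1 of \<open>y\<close>,
      so taking parities returns them; \<open>n div 2\<close> is the position within either
      subsequence.\<close>
    and d: "\<And>n. cf_digit n x = (if even n then of_bool (odd \<lfloor>2 ^ Suc (n div 2) * y\<rfloor>) else z (n div 2))"
    using cf_digits_surj 
    using cf_digits_surj[of "\<lambda>n. if even n then of_bool (odd \<lfloor>2 ^ Suc (n div 2) * y\<rfloor>) else z (n div 2)"]
    by blast
  have "parity_sum x = y"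
    unfolding parity_sum_def d using sums_unique[OF binary_expansion_floor[OF assms]] by simp
  moreover have "cf_digit (2 * n + 1) x = z n" for n
    unfolding d by simp
  ultimately show ?thesis using x by blast
qed

subsection \<open>Cardinals\<close>

lemma continuum_eq: "continuum = |UNIV :: (nat \<Rightarrow> bool) set|"
  unfolding continuum_def cexp_def ctwo_def by (simp add: Field_natLeq Field_card_of Func_def)

lemma continuum_ordLeq_unit_interval: "continuum \<le>o |{0..<1::real}|"
proof -
  obtain h :: "nat set \<Rightarrow> real" where h: "inj h" "range h \<subseteq> {0..<1}"
    using nat_sets_lepoll_reals01 unfolding lepoll_def by blast
  have "inj (h \<circ> Collect)"
    by (rule inj_compose[OF h(1)]) (auto intro: injI)
  with h(2) show ?thesis
    unfolding continuum_eq by (intro card_of_ordLeqI[of "h \<circ> Collect"]) (auto simp del: atLeastLessThan_iff)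
qed

lemma countable_ordLeq_nat: "countable A \<Longrightarrow> |A| \<le>o |UNIV :: nat set|"
  by (rule card_of_ordLeqI[OF inj_on_to_nat_on]) auto

lemma countable_ordLess_continuum:
  assumes "countable A"
  shows "|A| <o continuum"
proof -
  have "|UNIV :: nat set| <o continuum"
    unfolding continuum_def
    by (rule ordIso_ordLess_trans[OF card_of_nat ordLess_ctwo_cexp[OF natLeq_Card_order]])
  then show ?thesis by (rule ordLeq_ordLess_trans[OF countable_ordLeq_nat[OF assms]])
qed

lemma infinite_continuum: "infinite (UNIV :: (nat \<Rightarrow> bool) set)"
  using card_of_ordLeq_infinite[OF ordLess_imp_ordLeq[OF
      countable_ordLess_continuum[of "UNIV :: nat set", unfolded continuum_eq]]] by simp

text \<open>The hypothesis on the dominating number enters the construction here.\<close>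

lemma not_dominating_if_ordLess:
  assumes "dominating_number =o continuum" and "|D| <o continuum"
  obtains z where "\<And>g. g \<in> D \<Longrightarrow> \<not> z \<le>* g"
proof -
  have "\<not> dominating D"
  proof
    assume "dominating D"
    from ordLeq_ordLess_trans[OF dominating_number_least(2)[OF this] assms(2)]
    have "dominating_number <o continuum" .
    with assms(1) show False using not_ordLess_ordIso by blast
  qed
  then show thesis using that unfolding dominating_def by blast
qed

text \<open>The union has size at most |I| + \<aleph>0, which stays below the continuum even if the
  continuum is singular.\<close>

lemma UN_countable_ordLess_continuum:
  assumes "|I| <o continuum" and "\<And>i. i \<in> I \<Longrightarrow> countable (A i)"
  shows "|\<Union>i\<in>I. A i| <o continuum"
proof -
  let ?B = "I <+> (UNIV :: nat set)"
  have "|UNIV :: nat set| <o continuum"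
    by (rule countable_ordLess_continuum) simp
  with assms(1) have B: "|?B| <o continuum"
    unfolding continuum_eq by (intro card_of_Plus_ordLess_infinite infinite_continuum)
  have "|\<Union>i\<in>I. A i| \<le>o |?B|"
  proof (rule card_of_UNION_ordLeq_infinite)
    show "infinite ?B" by simp
    show "|I| \<le>o |?B|" by (rule card_of_Plus1)
    show "\<forall>i\<in>I. |A i| \<le>o |?B|"
    proof
      fix i assume "i \<in> I"
      then have "|A i| \<le>o |UNIV :: nat set|"
        by (intro countable_ordLeq_nat assms(2))
      then show "|A i| \<le>o |?B|" using card_of_Plus2 ordLeq_transitive by blast
    qed
  qed
  from this B show ?thesis by (rule ordLeq_ordLess_trans)
qed

subsection \<open>Construction of the set\<close>

text \<open>A code selects the basic open sets whose union is the complement. Codes have type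
  \<open>nat \<Rightarrow> bool\<close>, the field of \<open>continuum\<close>, so they also serve
  as stages of the recursion.\<close>

lemma closed_sets_parametrization:
  obtains C :: "(nat \<Rightarrow> bool) \<Rightarrow> 'a::euclidean_space set"
  where "\<And>S. closed S \<Longrightarrow> \<exists>c. C c = S"
proof (rule univ_second_countable_sequence)
  fix B :: "nat \<Rightarrow> 'a set"
  assume B: "\<And>S. open S \<Longrightarrow> \<exists>k. S = \<Union>{B n |n. n \<in> k}"
  show thesis
  proof (rule that[of "\<lambda>c. - \<Union>{B n |n. c n}"])
    fix S :: "'a set"
    assume "closed S"
    obtain k where k: "- S = \<Union>{B n |n. n \<in> k}"
      using B[OF open_Compl[OF \<open>closed S\<close>]] by (rule exE)
    have "- \<Union>{B n |n. n \<in> k} = S" unfolding k[symmetric] by (rule double_complement)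
    then show "\<exists>c. - \<Union>{B n |n. c n} = S" by (rule exI[of _ "\<lambda>n. n \<in> k"])
  qed
qed

text \<open>A common property of the two kinds of closed sets to be treated: closures of graphs of
  uniformly continuous functions, and products of a compact set of irrationals with the
  line.\<close>

definition rational_sections_countable :: "(real \<times> real) set \<Rightarrow> bool" where
  "rational_sections_countable C \<longleftrightarrow> closed C \<and> (\<forall>q\<in>{0..1} \<inter> \<rat>. countable {y. (q, y) \<in> C})"

lemma exists_point_avoiding:
  fixes \<C> :: "(real \<times> real) set set"
  assumes dc: "dominating_number =o continuum"
    and C: "|\<C>| <o continuum" "\<And>C. C \<in> \<C> \<Longrightarrow> rational_sections_countable C"
    and Y: "|Y| <o continuum"
  shows "\<exists>x\<in>irrationals01. parity_sum x \<notin> Y \<and> (\<forall>C\<in>\<C>. (x, parity_sum x) \<notin> C)"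
proof -
  \<comment> \<open>These are the values whose horizontal section of some \<open>C\<close> contains
    a rational of the unit interval.\<close>
  define S where "S = (\<Union>C\<in>\<C>. \<Union>q\<in>{0..1} \<inter> \<rat>. {y. (q, y) \<in> C})"
  have "|S| <o continuum"
    unfolding S_def
    by (rule UN_countable_ordLess_continuum[OF C(1)])
      (use C(2) in \<open>auto simp: rational_sections_countable_def intro!: countable_UN countable_Int2 countable_rat\<close>)
  then have "|Y \<union> S| <o continuum"
    using Y unfolding continuum_eq by (intro card_of_Un_ordLess_infinite infinite_continuum)
  then have "\<not> {0..<1} \<subseteq> Y \<union> S"
    using continuum_ordLeq_unit_interval card_of_mono1 not_ordLess_ordLeq ordLeq_transitive by blast
  then obtain y where y: "0 \<le> y" "y < 1" "y \<notin> Y" "y \<notin> S"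
    by (metis UnCI atLeastLessThan_iff subsetI)
  define K where "K C = {x \<in> {0..1}. (x, y) \<in> C}" for C :: "(real \<times> real) set"
  have K: "compact (K C) \<and> K C \<subseteq> irrationals01" if "C \<in> \<C>" for C
  proof
    have "closed ((\<lambda>x. (x, y)) -` C)"
      using C(2)[OF that] unfolding rational_sections_countable_def
      by (intro continuous_closed_vimage) (auto intro!: continuous_intros)
    moreover have "K C = {0..1} \<inter> (\<lambda>x. (x, y)) -` C" unfolding K_def by auto
    ultimately show "compact (K C)" by (simp add: compact_Int_closed)
    show "K C \<subseteq> irrationals01"
      using y(4) that unfolding S_def K_def irrationals01_def by blast
  qed
  have "\<exists>g. \<forall>x\<in>K C. \<forall>n. cf_digit n x \<le> g n" if "C \<in> \<C>" for C
    using K[OF that] cf_digit_bounded_on_compact by metis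
  then obtain g where g: "\<And>C x n. C \<in> \<C> \<Longrightarrow> x \<in> K C \<Longrightarrow> cf_digit n x \<le> g C n"
    by metis
  \<comment> \<open>Only odd positions are compared, because the even-indexed digits are reserved
    for coding \<open>y\<close>.\<close>
  have "|(\<lambda>C n. g C (2 * n + 1)) ` \<C>| <o continuum"
    using card_of_image C(1) by (rule ordLeq_ordLess_trans)
  then obtain z where z: "\<And>C. C \<in> \<C> \<Longrightarrow> \<not> z \<le>* (\<lambda>n. g C (2 * n + 1))"
    using not_dominating_if_ordLess[OF dc] by (metis image_eqI)
  obtain x where x: "x \<in> irrationals01" "parity_sum x = y" "\<And>n. cf_digit (2 * n + 1) x = z n"
    using parity_sum_fibre[OF y(1,2), of z] by blast
  have "(x, y) \<notin> C" if "C \<in> \<C>" for C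
  proof
    assume "(x, y) \<in> C"
    with x(1) have "x \<in> K C" unfolding K_def irrationals01_iff by simp
    then have "z n \<le> g C (2 * n + 1)" for n
      using g[OF that, of x "2 * n + 1"] x(3)[of n] by simp
    with z[OF that] show False by (simp add: eventually_dominated_def)
  qed
  with x y(3) show ?thesis by blast
qed

text \<open>The recursion runs along the well-order \<open>continuum\<close>, whose proper initial
  segments are small: stage \<open>a\<close> avoids all earlier values of \<open>parity_sum\<close>
  and all admissible closed sets coded by earlier stages.\<close>

lemma exists_thin_set:
  assumes dc: "dominating_number =o continuum"
  shows "\<exists>E\<subseteq>irrationals01. |E| =o continuum \<and>
    (\<forall>C. rational_sections_countable C \<longrightarrow> |{x \<in> E. (x, parity_sum x) \<in> C}| <o continuum)"
proof -
  obtain C :: "(nat \<Rightarrow> bool) \<Rightarrow> (real \<times> real) set"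
    where C: "\<And>S. closed S \<Longrightarrow> \<exists>c. C c = S"
    using closed_sets_parametrization by metis
  note co = continuum_bounds(1)
  have wo: "Well_order continuum" using co by (simp add: card_order_on_def)
  have Field: "Field continuum = UNIV" by (simp add: continuum_eq Field_card_of)
  have small: "|underS continuum a| <o continuum" for a
    by (rule card_of_underS[OF co]) (simp add: Field)
  let ?P = "\<lambda>x a v. v \<in> irrationals01 \<and> parity_sum v \<notin> (\<lambda>b. parity_sum (x b)) ` underS continuum a \<and>
    (\<forall>b\<in>underS continuum a. rational_sections_countable (C b) \<longrightarrow> (v, parity_sum v) \<notin> C b)"
  have "\<exists>x. \<forall>a. ?P x a (x a)"
  proof (rule dependent_wf_choice[of "continuum - Id"])
    show "wf (continuum - Id)" using wo by (simp add: well_order_on_def)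
    \<comment> \<open>The requirement at \<open>a\<close> depends only on the choices strictly below
      \<open>a\<close>.\<close>
    show "?P f a r = ?P g a r" if "\<And>b. (b, a) \<in> continuum - Id \<Longrightarrow> f b = g b" for f g a r
    proof -
      have "(\<lambda>b. parity_sum (f b)) ` underS continuum a = (\<lambda>b. parity_sum (g b)) ` underS continuum a"
        using that by (intro image_cong) (auto simp: underS_def)
      then show ?thesis by simp
    qed
    show "\<exists>r. ?P f a r" for a f
    proof -
      let ?\<C> = "{S \<in> C ` underS continuum a. rational_sections_countable S}"
      have "|?\<C>| \<le>o |underS continuum a|"
        by (rule ordLeq_transitive[OF card_of_mono1 card_of_image]) blast
      then have "|?\<C>| <o continuum" using small by (rule ordLeq_ordLess_trans)
      moreover have "|(\<lambda>b. parity_sum (f b)) ` underS continuum a| <o continuum"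
        using card_of_image small by (rule ordLeq_ordLess_trans)
      ultimately obtain v where v: "v \<in> irrationals01"
        "parity_sum v \<notin> (\<lambda>b. parity_sum (f b)) ` underS continuum a"
        "\<forall>S\<in>?\<C>. (v, parity_sum v) \<notin> S"
        using exists_point_avoiding[OF dc, of ?\<C>] by blast
      then show ?thesis by (intro exI[of _ v]) simp
    qed
  qed
  then obtain x where "\<forall>a. ?P x a (x a)" by (rule exE)
  then have x: "?P x a (x a)" for a by (rule spec)
  have total: "a \<in> underS continuum b \<or> b \<in> underS continuum a" if "a \<noteq> b" for a b
  proof -
    have "total_on UNIV continuum" using wo by (simp add: well_order_on_def linear_order_on_def Field)
    with that show ?thesis unfolding total_on_def underS_def by blast
  qed
  \<comment> \<open>Distinct stages have distinct values of \<open>parity_sum\<close>, hence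
    distinct points; this gives the full cardinality.\<close>
  have "inj x"
  proof (rule injI, rule ccontr)
    fix a b assume "x a = x b" "a \<noteq> b"
    from total[OF \<open>a \<noteq> b\<close>] show False
    proof
      assume "a \<in> underS continuum b"
      then have "parity_sum (x a) \<in> (\<lambda>b. parity_sum (x b)) ` underS continuum b" by (rule imageI)
      with x[of b] \<open>x a = x b\<close> show False by simp
    next
      assume "b \<in> underS continuum a"
      then have "parity_sum (x b) \<in> (\<lambda>b. parity_sum (x b)) ` underS continuum a" by (rule imageI)
      with x[of a] \<open>x a = x b\<close> show False by simp
    qed
  qed
  show ?thesis
  proof (intro exI[of _ "range x"] conjI allI impI)
    show "range x \<subseteq> irrationals01" using x by blast
    show "|range x| =o continuum"
      unfolding continuum_eq
      by (rule ordIso_symmetric[OF card_of_ordIsoI[of x]]) (simp add: bij_betw_def \<open>inj x\<close>)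
    fix S assume S: "rational_sections_countable S"
    then obtain c where c: "C c = S" using C unfolding rational_sections_countable_def by blast
    \<comment> \<open>Points chosen after stage \<open>c\<close> avoid \<open>C c\<close>, so only
      those from stages up to \<open>c\<close> can meet it.\<close>
    have "{v \<in> range x. (v, parity_sum v) \<in> S} \<subseteq> x ` (underS continuum c \<union> {c})"
    proof
      fix v assume "v \<in> {v \<in> range x. (v, parity_sum v) \<in> S}"
      then obtain a where a: "v = x a" "(x a, parity_sum (x a)) \<in> C c" unfolding c by blast
      then have "c \<notin> underS continuum a" using x[of a] S unfolding c[symmetric] by blast
      then have "a \<in> underS continuum c \<or> a = c" using total by blast
      with a(1) show "v \<in> x ` (underS continuum c \<union> {c})" by blast
    qed
    then have "|{v \<in> range x. (v, parity_sum v) \<in> S}| \<le>o |underS continuum c \<union> {c}|"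
      by (rule ordLeq_transitive[OF card_of_mono1 card_of_image])
    moreover have "|underS continuum c \<union> {c}| <o continuum"
    proof -
      have "|{c}| <o continuum"
        by (rule countable_ordLess_continuum) simp
      with small[of c] show ?thesis
        unfolding continuum_eq by (intro card_of_Un_ordLess_infinite infinite_continuum)
    qed
    ultimately show "|{v \<in> range x. (v, parity_sum v) \<in> S}| <o continuum"
      by (rule ordLeq_ordLess_trans)
  qed
qed

section \<open>Closures of graphs of uniformly continuous functions\<close>

text \<open>Points of \<open>A\<close> close to \<open>q\<close> are close to each other, so their
  values cannot approach two different limits. The point \<open>q\<close> may lie outside
  \<open>A\<close>, as the rationals will.\<close>

lemma closure_graph_single_valued:
  fixes f :: "'a::metric_space \<Rightarrow> 'b::metric_space"
  assumes uc: "uniformly_continuous_on A f"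
    and v: "(q, v) \<in> closure ((\<lambda>x. (x, f x)) ` A)" and w: "(q, w) \<in> closure ((\<lambda>x. (x, f x)) ` A)"
  shows "v = w"
proof (rule ccontr)
  assume "v \<noteq> w"
  \<comment> \<open>A third, for the three distances from \<open>v\<close> to \<open>f x\<close>, to
    \<open>f x'\<close>, to \<open>w\<close>.\<close>
  define e where "e = dist v w / 3"
  have e: "0 < e" using \<open>v \<noteq> w\<close> by (simp add: e_def)
  obtain d where d: "0 < d" "\<And>x x'. x \<in> A \<Longrightarrow> x' \<in> A \<Longrightarrow> dist x' x < d \<Longrightarrow> dist (f x') (f x) < e"
    using uc[unfolded uniformly_continuous_on_def, rule_format, OF e] by blast
  have near: "\<exists>x\<in>A. dist x q < d / 2 \<and> dist (f x) u < e"
    if "(q, u) \<in> closure ((\<lambda>x. (x, f x)) ` A)" for u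
  proof -
    have "0 < min (d / 2) e" using d(1) e by simp
    with that have "\<exists>x\<in>A. dist (x, f x) (q, u) < min (d / 2) e"
      by (simp only: closure_approachable bex_simps)
    then obtain x where x: "x \<in> A" "dist (x, f x) (q, u) < min (d / 2) e" by (rule bexE)
    have "dist x q \<le> dist (x, f x) (q, u)" "dist (f x) u \<le> dist (x, f x) (q, u)"
      using dist_fst_le[of "(x, f x)" "(q, u)"] dist_snd_le[of "(x, f x)" "(q, u)"]
      unfolding fst_conv snd_conv .
    with x(2) have "dist x q < d / 2" "dist (f x) u < e" by linarith+
    with x(1) show ?thesis by blast
  qed
  obtain x where x: "x \<in> A" "dist x q < d / 2" "dist (f x) v < e" using near[OF v] by blast
  obtain x' where x': "x' \<in> A" "dist x' q < d / 2" "dist (f x') w < e" using near[OF w] by blast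
  have "dist x' x < d" using x(2) x'(2) dist_triangle2[of x' x q] by linarith
  then have "dist (f x') (f x) < e" by (rule d(2)[OF x(1) x'(1)])
  moreover have "dist v w \<le> dist v (f x) + dist (f x) (f x') + dist (f x') w"
    using dist_triangle[of v w "f x"] dist_triangle[of "f x" w "f x'"] by linarith
  ultimately show False using x(3) x'(3) unfolding e_def dist_commute[of v] dist_commute[of "f x" "f x'"] by linarith
qed

theorem theorem3p4:
  assumes "dominating_number =o continuum"
  shows "(\<exists>(E :: real set) (f :: real \<Rightarrow> real).
            K_Lusin continuum (top_of_set irrationals01) E \<and> |E| =o continuum \<and>
            continuous_on E f \<and>
            (\<forall>A\<subseteq>E. |A| =o continuum \<longrightarrow> \<not> uniformly_continuous_on A f))
         \<and> C8_continuum"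
proof -
  obtain E where E: "E \<subseteq> irrationals01" "|E| =o continuum"
    and "\<forall>C. rational_sections_countable C \<longrightarrow> |{x \<in> E. (x, parity_sum x) \<in> C}| <o continuum"
    using exists_thin_set[OF assms] by blast
  note thin = this(3)[rule_format]
  have "uncountable E"
  proof
    assume "countable E"
    from not_ordLess_ordIso[OF countable_ordLess_continuum[OF this]] E(2) show False by contradiction
  qed
  have small: "|E \<inter> K| <o continuum" if "compactin (top_of_set irrationals01) K" for K
  proof -
    from that have K: "compact K" "K \<subseteq> irrationals01"
      by (simp_all add: compactin_subtopology)
    \<comment> \<open>Membership of \<open>(x, parity_sum x)\<close> in this product just says that
      \<open>x\<close> lies in \<open>K\<close>, and its sections over rationals are empty.\<close>
    have "rational_sections_countable (K \<times> UNIV)"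
      unfolding rational_sections_countable_def
    proof (intro conjI ballI)
      show "closed (K \<times> (UNIV :: real set))" by (intro closed_Times compact_imp_closed K closed_UNIV)
      fix q :: real assume "q \<in> {0..1} \<inter> \<rat>"
      with K(2) have "q \<notin> K" unfolding irrationals01_def by blast
      then show "countable {y::real. (q, y) \<in> K \<times> UNIV}" by simp
    qed
    moreover have "{x \<in> E. (x, parity_sum x) \<in> K \<times> UNIV} = E \<inter> K" by blast
    ultimately show ?thesis using thin by metis
  qed
  have lusin: "K_Lusin continuum (top_of_set irrationals01) E"
    unfolding K_Lusin_def topspace_euclidean_subtopology
    by (intro conjI allI impI Polish_irrationals01 continuum_bounds E(1) \<open>uncountable E\<close>)
      (rule small)
  have cont: "continuous_on E parity_sum"
    using continuous_on_parity_sum E(1) by (rule continuous_on_subset)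
  have not_uc: "\<not> uniformly_continuous_on A parity_sum" if A: "A \<subseteq> E" "|A| =o continuum" for A
  proof
    assume uc: "uniformly_continuous_on A parity_sum"
    let ?C = "closure ((\<lambda>x. (x, parity_sum x)) ` A)"
    have "countable {y. (q, y) \<in> ?C}" for q
    proof (cases "\<exists>v. (q, v) \<in> ?C")
      case True
      then obtain v where "(q, v) \<in> ?C" by blast
      then have "{y. (q, y) \<in> ?C} \<subseteq> {v}"
        by (auto dest: closure_graph_single_valued[OF uc])
      then show ?thesis by (rule countable_subset) simp
    qed simp
    then have "rational_sections_countable ?C" unfolding rational_sections_countable_def by simp
    note small_C = thin[OF this]
    \<comment> \<open>The whole of \<open>A\<close> lies over the closure of its own graph, so
      thinness of \<open>E\<close> makes \<open>A\<close> too small.\<close>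
    have "A \<subseteq> {x \<in> E. (x, parity_sum x) \<in> ?C}"
    proof
      fix x assume "x \<in> A"
      moreover from this have "(x, parity_sum x) \<in> ?C"
        by (intro subsetD[OF closure_subset] imageI)
      ultimately show "x \<in> {x \<in> E. (x, parity_sum x) \<in> ?C}" using A(1) by simp blast
    qed
    from ordLeq_ordLess_trans[OF card_of_mono1[OF this] small_C] have "|A| <o continuum" .
    from not_ordLess_ordIso[OF this] A(2) show False by contradiction
  qed
  show ?thesis
    unfolding C8_continuum_def
    by (rule conjI; intro exI[of _ E] exI[of _ parity_sum] conjI allI impI lusin cont E(2) not_uc)
qed

end
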